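(* Let $\phi\in\mathcal{A}$, and let $f_j=h_j+\overline{g_j}\in\mathcal{S}_{\mathcal H}^0$ $(j=1,2)$ with $f_j\in\mathcal{W}_{\mathcal H}^{-1}(\phi)$, i.e. $h_j-g_j=\phi$ for $j=1,2$. If $\phi$ is convex in the direction of the real axis, then $f_3=tf_1+(1-t)f_2$ $(0\le t\le 1)$ is univalent and convex in the direction of the real axis.
   Context: $\mathbb{D}=\{z\in\mathbb{C}:|z|<1\}$. $\mathcal H$ is the class of complex-valued harmonic functions $f$ in $\mathbb D$ with $f(0)=f_{\bar z}(0)=f_z(0)-1=0$; each is written $f=h+\overline g$ with $h(z)=z+\sum_{n\ge2}a_nz^n$ and $g(z)=\sum_{n\ge2}b_nz^n$ analytic in $\mathbb D$. $\mathcal S_{\mathcal H}^0$ is the subclass of $\mathcal H$ of univalent, sense-preserving functions (a function in $\mathcal H$ is locally univalent and sense-preserving if and only if $|g'|<|h'|$ in $\mathbb D$). $\mathcal A$ is the subclass of $\mathcal H$ of normalized analytic functions. For $\phi\in\mathcal A$ and $|\lambda|=1$, $\mathcal W_{\mathcal H}^\lambda(\phi)=\{h+\overline g\in\mathcal H: h+\lambda g=\phi\}$. A domain is convex in the direction of the real axis if its intersection with each horizontal line is connected or empty; a function in $\mathcal H$ is convex in the direction of the real axis if it maps $\mathbb D$ onto such a domain.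
   Formalization: The formal statement additionally assumes that φ is univalent in the disc; if convexity in the direction of the real axis is read only as a condition on the image φ(D), the claim fails for some non-univalent φ, even with f_1=f_2. *)

theory Defs
  imports "HOL-Complex_Analysis.Complex_Analysis"
begin

abbreviation unit_disc :: "complex set" where
  "unit_disc \<equiv> ball 0 1"

definition partial_x :: "(complex \<Rightarrow> complex) \<Rightarrow> complex \<Rightarrow> complex" where
  "partial_x f z = vector_derivative (\<lambda>t::real. f (z + of_real t)) (at 0)"

definition partial_y :: "(complex \<Rightarrow> complex) \<Rightarrow> complex \<Rightarrow> complex" where
  "partial_y f z = vector_derivative (\<lambda>t::real. f (z + \<i> * of_real t)) (at 0)"

definition wirtinger_z :: "(complex \<Rightarrow> complex) \<Rightarrow> complex \<Rightarrow> complex" where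
  "wirtinger_z f z = (partial_x f z - \<i> * partial_y f z) / 2"

definition wirtinger_zbar :: "(complex \<Rightarrow> complex) \<Rightarrow> complex \<Rightarrow> complex" where
  "wirtinger_zbar f z = (partial_x f z + \<i> * partial_y f z) / 2"

(* differentiable_on is real differentiability here: the class is C^2, not holomorphic. *)
definition twice_cont_differentiable_on :: "(complex \<Rightarrow> complex) \<Rightarrow> complex set \<Rightarrow> bool" where
  "twice_cont_differentiable_on f S \<longleftrightarrow>
     f differentiable_on S \<and>
     partial_x f differentiable_on S \<and> partial_y f differentiable_on S \<and>
     continuous_on S (partial_x (partial_x f)) \<and> continuous_on S (partial_x (partial_y f)) \<and>
     continuous_on S (partial_y (partial_x f)) \<and> continuous_on S (partial_y (partial_y f))"

definition harmonic_on :: "(complex \<Rightarrow> complex) \<Rightarrow> complex set \<Rightarrow> bool" where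
  "harmonic_on f S \<longleftrightarrow> open S \<and> twice_cont_differentiable_on f S \<and>
     (\<forall>z\<in>S. partial_x (partial_x f) z + partial_y (partial_y f) z = 0)"

definition class_H :: "(complex \<Rightarrow> complex) set" where
  "class_H = {f. harmonic_on f unit_disc \<and>
     f 0 = 0 \<and> wirtinger_zbar f 0 = 0 \<and> wirtinger_z f 0 - 1 = 0}"

(* The normalisations say that the power series of h is z + O(z^2) and that of g is O(z^2). *)
definition canonical_rep ::
  "(complex \<Rightarrow> complex) \<Rightarrow> (complex \<Rightarrow> complex) \<Rightarrow> (complex \<Rightarrow> complex) \<Rightarrow> bool" where
  "canonical_rep f h g \<longleftrightarrow>
     h holomorphic_on unit_disc \<and> g holomorphic_on unit_disc \<and>
     h 0 = 0 \<and> deriv h 0 = 1 \<and> g 0 = 0 \<and> deriv g 0 = 0 \<and>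
     (\<forall>z\<in>unit_disc. f z = h z + cnj (g z))"

(* The Jacobian is |f_z|^2 - |f_zbar|^2; for f = h + cnj g this condition is |g'| < |h'|. *)
definition sense_preserving_on :: "(complex \<Rightarrow> complex) \<Rightarrow> complex set \<Rightarrow> bool" where
  "sense_preserving_on f S \<longleftrightarrow> (\<forall>z\<in>S. cmod (wirtinger_zbar f z) < cmod (wirtinger_z f z))"

definition class_SH0 :: "(complex \<Rightarrow> complex) set" where
  "class_SH0 = {f \<in> class_H. inj_on f unit_disc \<and> sense_preserving_on f unit_disc}"

definition class_A :: "(complex \<Rightarrow> complex) set" where
  "class_A = {f \<in> class_H. f holomorphic_on unit_disc}"

definition class_W :: "complex \<Rightarrow> (complex \<Rightarrow> complex) \<Rightarrow> (complex \<Rightarrow> complex) set" where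
  "class_W c \<phi> = {f \<in> class_H.
     \<exists>h g. canonical_rep f h g \<and> (\<forall>z\<in>unit_disc. h z + c * g z = \<phi> z)}"

definition domain_convex_real_dir :: "complex set \<Rightarrow> bool" where
  "domain_convex_real_dir \<Omega> \<longleftrightarrow> open \<Omega> \<and> connected \<Omega> \<and> \<Omega> \<noteq> {} \<and>
     (\<forall>y::real. connected (\<Omega> \<inter> {w. Im w = y}))"

definition convex_real_dir :: "(complex \<Rightarrow> complex) \<Rightarrow> bool" where
  "convex_real_dir f \<longleftrightarrow> domain_convex_real_dir (f ` unit_disc)"

end

theory Submission
  imports Defs
begin

text \<open>
  A harmonic function \<open>f = h + cnj g\<close> with \<open>h - g = \<phi>\<close> reads \<open>f = \<phi> + 2 Re g\<close>, so that \<open>f \<circ> \<phi>\<inverse>\<close>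
  moves the points of \<open>\<phi> ` \<bbbD>\<close> horizontally. The condition \<open>|g'| < |h'| = |\<phi>' + g'|\<close> has two
  readings. It says that \<open>1 + 2 Re (g' / \<phi>') > 0\<close>, i.e. that \<open>f \<circ> \<phi>\<inverse>\<close> is increasing along the horizontal
  sections of \<open>\<phi> ` \<bbbD>\<close>, which are intervals; hence \<open>f\<close> is univalent and convex in the direction
  of the real axis. It also says that \<open>g'\<close> lies in a half-plane depending only on \<open>\<phi>'\<close>, so it passes to
  convex combinations of functions with the same \<open>\<phi>\<close>.
\<close>

lemma norm_less_norm_add_iff:
  fixes u v :: "'a::real_inner"
  shows "norm v < norm (u + v) \<longleftrightarrow> 0 < u \<bullet> u + 2 * (u \<bullet> v)"
  by (simp add: norm_lt inner_simps inner_commute add.commute)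

lemma norm_less_norm_add_iff_Re_divide:
  fixes u v :: complex
  assumes "u \<noteq> 0"
  shows "cmod v < cmod (u + v) \<longleftrightarrow> 0 < 1 + 2 * Re (v / u)"
proof -
  have "u + v = u * (1 + v / u)"
    using assms by (simp add: field_simps)
  then have "cmod v < cmod (u + v) \<longleftrightarrow> cmod (v / u) < cmod (1 + v / u)"
    using assms by (simp add: norm_mult norm_divide field_simps)
  also have "\<dots> \<longleftrightarrow> 0 < 1 + 2 * Re (v / u)"
    using norm_less_norm_add_iff[of "v / u" 1] by simp
  finally show ?thesis .
qed

lemma convex_norm_less_norm_add:
  fixes u :: "'a::real_inner"
  shows "convex {v. norm v < norm (u + v)}"
proof -
  have "{v. norm v < norm (u + v)} = {v. u \<bullet> v > - (u \<bullet> u) / 2}"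
    by (auto simp: norm_less_norm_add_iff)
  then show ?thesis
    by (simp only: convex_halfspace_gt)
qed

lemma has_derivative_imp_has_vector_derivative_along_line:
  assumes "(f has_derivative D) (at (x + s *\<^sub>R v))"
  shows "((\<lambda>t. f (x + t *\<^sub>R v)) has_vector_derivative D v) (at s)"
proof -
  have "((\<lambda>t. x + t *\<^sub>R v) has_vector_derivative v) (at s)"
    by (auto intro!: derivative_eq_intros)
  from vector_derivative_diff_chain_within[OF this has_derivative_at_withinI[OF assms]]
  show ?thesis
    by (simp add: o_def)
qed

lemma has_derivative_imp_partial_x:
  assumes "(f has_derivative D) (at z)"
  shows "partial_x f z = D 1"
  using has_derivative_imp_has_vector_derivative_along_line[of f D z 0 1] assms
  by (simp add: partial_x_def scaleR_conv_of_real vector_derivative_at)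

lemma has_derivative_imp_partial_y:
  assumes "(f has_derivative D) (at z)"
  shows "partial_y f z = D \<i>"
  using has_derivative_imp_has_vector_derivative_along_line[of f D z 0 \<i>] assms
  by (simp add: partial_y_def scaleR_conv_of_real mult.commute vector_derivative_at)

lemma has_derivative_imp_wirtinger:
  assumes "(f has_derivative (\<lambda>v. a * v + cnj (b * v))) (at z)"
  shows "wirtinger_z f z = a" "wirtinger_zbar f z = cnj b"
  by (simp_all add: wirtinger_z_def wirtinger_zbar_def algebra_simps
      has_derivative_imp_partial_x[OF assms] has_derivative_imp_partial_y[OF assms])

lemma sense_preserving_on_add_cnj_iff:
  assumes "open S" and h: "h holomorphic_on S" and g: "g holomorphic_on S"
    and f: "\<And>z. z \<in> S \<Longrightarrow> f z = h z + cnj (g z)"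
  shows "sense_preserving_on f S \<longleftrightarrow> (\<forall>z\<in>S. cmod (deriv g z) < cmod (deriv h z))"
proof -
  have "(f has_derivative (\<lambda>v. deriv h z * v + cnj (deriv g z * v))) (at z)" if z: "z \<in> S" for z
  proof (rule has_derivative_transform_within_open)
    show "((\<lambda>z. h z + cnj (g z)) has_derivative (\<lambda>v. deriv h z * v + cnj (deriv g z * v))) (at z)"
      using holomorphic_derivI[OF h \<open>open S\<close> z] holomorphic_derivI[OF g \<open>open S\<close> z]
      unfolding has_field_derivative_def by (intro has_derivative_add has_derivative_cnj)
  qed (use assms z in auto)
  from has_derivative_imp_wirtinger[OF this] show ?thesis
    by (simp add: sense_preserving_on_def)
qed

lemma convex_horizontal_section:
  assumes "connected (\<Omega> \<inter> {w. Im w = y})"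
  shows "convex (\<Omega> \<inter> {w. Im w = y})"
proof -
  have "collinear (\<Omega> \<inter> {w. Im w = y})"
    by (auto simp: collinear_def complex_eq_iff intro!: exI[of _ "1::complex"])
  then show ?thesis
    using assms convex_connected_collinear by blast
qed

lemma partial_x_pos_imp_Re_less:
  assumes sec: "connected (\<Omega> \<inter> {w. Im w = Im v})"
    and F: "\<And>w. w \<in> \<Omega> \<Longrightarrow> F differentiable (at w)"
    and pos: "\<And>w. w \<in> \<Omega> \<Longrightarrow> 0 < Re (partial_x F w)"
    and vw: "v \<in> \<Omega>" "w \<in> \<Omega>" "Im v = Im w" "Re v < Re w"
  shows "Re (F v) < Re (F w)"
proof -
  define r where "r = Re w - Re v"
  have "0 < r" and w: "w = v + r *\<^sub>R 1"
    using vw by (auto simp: r_def complex_eq_iff)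
  have "Re (F (v + 0 *\<^sub>R 1)) < Re (F (v + r *\<^sub>R 1))"
  proof (rule DERIV_pos_imp_increasing[OF \<open>0 < r\<close>])
    fix s assume s: "0 \<le> s" "s \<le> r"
    have "v + s *\<^sub>R 1 = (1 - s / r) *\<^sub>R v + (s / r) *\<^sub>R w"
      using \<open>0 < r\<close> by (simp add: w algebra_simps)
    also have "\<dots> \<in> \<Omega> \<inter> {u. Im u = Im v}"
      using s \<open>0 < r\<close> vw by (intro convexD[OF convex_horizontal_section[OF sec]]) auto
    finally have mem: "v + s *\<^sub>R 1 \<in> \<Omega>"
      by simp
    then obtain D where D: "(F has_derivative D) (at (v + s *\<^sub>R 1))"
      using F unfolding differentiable_def by blast
    have "((\<lambda>s. Re (F (v + s *\<^sub>R 1))) has_real_derivative Re (D 1)) (at s)"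
      using has_derivative_imp_has_vector_derivative_along_line[OF D]
      by (simp add: has_vector_derivative_complex_iff)
    moreover have "0 < Re (D 1)"
      using pos[OF mem] by (simp add: has_derivative_imp_partial_x[OF D])
    ultimately show "\<exists>d. ((\<lambda>s. Re (F (v + s *\<^sub>R 1))) has_real_derivative d) (at s) \<and> 0 < d"
      by blast
  qed
  then show ?thesis
    by (simp flip: w)
qed

lemma partial_x_pos_imp_inj_on:
  assumes sec: "\<And>y. connected (\<Omega> \<inter> {w. Im w = y})"
    and F: "\<And>w. w \<in> \<Omega> \<Longrightarrow> F differentiable (at w)"
    and pos: "\<And>w. w \<in> \<Omega> \<Longrightarrow> 0 < Re (partial_x F w)"
    and Im: "\<And>w. w \<in> \<Omega> \<Longrightarrow> Im (F w) = Im w"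
  shows "inj_on F \<Omega>"
proof (rule inj_onI)
  fix v w assume vw: "v \<in> \<Omega>" "w \<in> \<Omega>" "F v = F w"
  then have "Im v = Im w"
    by (metis Im)
  moreover from this have "Re v = Re w"
    using vw partial_x_pos_imp_Re_less[OF sec F pos, of v w]
      partial_x_pos_imp_Re_less[OF sec F pos, of w v]
    by (cases "Re v" "Re w" rule: linorder_cases) auto
  ultimately show "v = w"
    by (simp add: complex_eq_iff)
qed

lemma domain_convex_real_dir_image:
  assumes dom: "domain_convex_real_dir \<Omega>" and cont: "continuous_on \<Omega> F" and inj: "inj_on F \<Omega>"
    and Im: "\<And>w. w \<in> \<Omega> \<Longrightarrow> Im (F w) = Im w"
  shows "domain_convex_real_dir (F ` \<Omega>)"
proof -
  have "connected (F ` \<Omega> \<inter> {w. Im w = y})" for y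
  proof -
    have "F ` \<Omega> \<inter> {w. Im w = y} = F ` (\<Omega> \<inter> {w. Im w = y})"
      using Im by auto
    moreover have "connected (\<Omega> \<inter> {w. Im w = y})"
      using dom by (simp add: domain_convex_real_dir_def)
    ultimately show ?thesis
      using connected_continuous_image continuous_on_subset[OF cont] by (metis inf_le1)
  qed
  moreover have "open (F ` \<Omega>)"
    using dom by (intro invariance_of_domain cont inj) (simp add: domain_convex_real_dir_def)
  moreover have "connected (F ` \<Omega>)"
    using dom by (intro connected_continuous_image cont) (simp add: domain_convex_real_dir_def)
  ultimately show ?thesis
    using dom by (simp add: domain_convex_real_dir_def)
qed

lemma horizontal_shear_inj_on_convex_real_dir:
  assumes dom: "domain_convex_real_dir \<Omega>" and G: "G holomorphic_on \<Omega>"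
    and pos: "\<And>w. w \<in> \<Omega> \<Longrightarrow> 0 < 1 + 2 * Re (deriv G w)"
  defines "F \<equiv> \<lambda>w. w + complex_of_real (2 * Re (G w))"
  shows "inj_on F \<Omega>" "domain_convex_real_dir (F ` \<Omega>)"
proof -
  have "open \<Omega>" and sec: "\<And>y. connected (\<Omega> \<inter> {w. Im w = y})"
    using dom by (auto simp: domain_convex_real_dir_def)
  have F': "(F has_derivative (\<lambda>v. v + complex_of_real (2 * Re (deriv G w * v)))) (at w)"
    if "w \<in> \<Omega>" for w
    using holomorphic_derivI[OF G \<open>open \<Omega>\<close> that] unfolding F_def has_field_derivative_def
    by (auto intro!: derivative_eq_intros)
  then have diff: "F differentiable (at w)" if "w \<in> \<Omega>" for w
    using that unfolding differentiable_def by blast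
  have Im: "Im (F w) = Im w" for w
    by (simp add: F_def)
  show inj: "inj_on F \<Omega>"
    using pos by (intro partial_x_pos_imp_inj_on sec diff Im)
      (simp_all add: has_derivative_imp_partial_x[OF F'])
  have "continuous_on \<Omega> F"
    using diff by (intro differentiable_imp_continuous_on differentiable_at_imp_differentiable_on)
  then show "domain_convex_real_dir (F ` \<Omega>)"
    using domain_convex_real_dir_image[OF dom _ inj Im] by blast
qed

definition sense_preserving_shear_on ::
  "(complex \<Rightarrow> complex) \<Rightarrow> (complex \<Rightarrow> complex) \<Rightarrow> (complex \<Rightarrow> complex) \<Rightarrow> complex set \<Rightarrow> bool" where
  "sense_preserving_shear_on f \<phi> g S \<longleftrightarrow> g holomorphic_on S \<and>
     (\<forall>z\<in>S. f z = \<phi> z + complex_of_real (2 * Re (g z))) \<and>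
     (\<forall>z\<in>S. cmod (deriv g z) < cmod (deriv \<phi> z + deriv g z))"

lemma sense_preserving_shear_on_add_cnj:
  assumes S: "open S" and h: "h holomorphic_on S" and g: "g holomorphic_on S"
    and f: "\<And>z. z \<in> S \<Longrightarrow> f z = h z + cnj (g z)" and \<phi>: "\<And>z. z \<in> S \<Longrightarrow> \<phi> z = h z - g z"
    and sp: "sense_preserving_on f S"
  shows "sense_preserving_shear_on f \<phi> g S"
proof -
  have "deriv \<phi> z + deriv g z = deriv h z" if z: "z \<in> S" for z
  proof -
    have "((\<lambda>z. h z - g z) has_field_derivative deriv h z - deriv g z) (at z)"
      by (intro DERIV_diff holomorphic_derivI[OF _ S z] h g)
    then have "(\<phi> has_field_derivative deriv h z - deriv g z) (at z)"
      by (rule has_field_derivative_transform_within_open[OF _ S z]) (simp add: \<phi>)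
    then show ?thesis
      by (simp add: DERIV_imp_deriv)
  qed
  moreover have "f z = \<phi> z + complex_of_real (2 * Re (g z))" if "z \<in> S" for z
    using that by (simp add: f \<phi> complex_eq_iff)
  moreover have "\<forall>z\<in>S. cmod (deriv g z) < cmod (deriv h z)"
    using sense_preserving_on_add_cnj_iff[OF S h g f] sp by blast
  ultimately show ?thesis
    using g by (simp add: sense_preserving_shear_on_def)
qed

lemma class_SH0_class_W_shearE:
  assumes "f \<in> class_SH0" and "f \<in> class_W (-1) \<phi>"
  obtains g where "sense_preserving_shear_on f \<phi> g unit_disc"
proof -
  obtain h g where "canonical_rep f h g" and "\<forall>z\<in>unit_disc. \<phi> z = h z - g z"
    using assms(2) by (auto simp: class_W_def)
  moreover have "sense_preserving_on f unit_disc"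
    using assms(1) by (simp add: class_SH0_def)
  ultimately have "sense_preserving_shear_on f \<phi> g unit_disc"
    by (intro sense_preserving_shear_on_add_cnj) (auto simp: canonical_rep_def)
  then show thesis
    by (rule that)
qed

lemma sense_preserving_shear_on_convex_combination:
  assumes S: "open S" and t: "0 \<le> t" "t \<le> 1"
    and shear1: "sense_preserving_shear_on f1 \<phi> g1 S"
    and shear2: "sense_preserving_shear_on f2 \<phi> g2 S"
  shows "sense_preserving_shear_on (\<lambda>z. of_real t * f1 z + of_real (1 - t) * f2 z) \<phi>
    (\<lambda>z. of_real t * g1 z + of_real (1 - t) * g2 z) S"
    (is "sense_preserving_shear_on ?f \<phi> ?g S")
proof -
  have g1: "g1 holomorphic_on S" and g2: "g2 holomorphic_on S"
    using shear1 shear2 by (simp_all add: sense_preserving_shear_on_def)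
  have "cmod (deriv ?g z) < cmod (deriv \<phi> z + deriv ?g z)" if z: "z \<in> S" for z
  proof -
    have "deriv ?g z = t *\<^sub>R deriv g1 z + (1 - t) *\<^sub>R deriv g2 z"
      unfolding scaleR_conv_of_real
      by (intro DERIV_imp_deriv DERIV_add DERIV_cmult holomorphic_derivI[OF _ S z] g1 g2)
    also have "\<dots> \<in> {v. cmod v < cmod (deriv \<phi> z + v)}"
      using shear1 shear2 t z
      by (intro convexD[OF convex_norm_less_norm_add]) (auto simp: sense_preserving_shear_on_def)
    finally show ?thesis
      by simp
  qed
  moreover have "?f z = \<phi> z + complex_of_real (2 * Re (?g z))" if "z \<in> S" for z
    using shear1 shear2 that
    by (simp add: sense_preserving_shear_on_def complex_eq_iff algebra_simps)
  moreover have "?g holomorphic_on S"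
    by (intro holomorphic_intros g1 g2)
  ultimately show ?thesis
    by (simp add: sense_preserving_shear_on_def)
qed

lemma clunie_sheil_small_shear:
  assumes "open S" and \<phi>: "\<phi> holomorphic_on S" and inj: "inj_on \<phi> S"
    and dom: "domain_convex_real_dir (\<phi> ` S)" and shear: "sense_preserving_shear_on f \<phi> g S"
  shows "inj_on f S" "domain_convex_real_dir (f ` S)"
proof -
  obtain \<psi> where \<psi>: "\<psi> holomorphic_on \<phi> ` S"
    and \<psi>': "\<And>z. z \<in> S \<Longrightarrow> deriv \<phi> z * deriv \<psi> (\<phi> z) = 1"
    and inv: "\<And>z. z \<in> S \<Longrightarrow> \<psi> (\<phi> z) = z"
    using holomorphic_has_inverse[OF \<phi> \<open>open S\<close> inj] by metis
  define F where "F = (\<lambda>w. w + complex_of_real (2 * Re ((g \<circ> \<psi>) w)))"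
  have g: "g holomorphic_on S"
    using shear by (simp add: sense_preserving_shear_on_def)
  have G: "g \<circ> \<psi> holomorphic_on \<phi> ` S"
    by (rule holomorphic_on_compose_gen[OF \<psi> g]) (use inv in auto)
  have "open (\<phi> ` S)"
    using dom by (simp add: domain_convex_real_dir_def)
  have pos: "0 < 1 + 2 * Re (deriv (g \<circ> \<psi>) w)" if "w \<in> \<phi> ` S" for w
  proof -
    from that obtain z where z: "z \<in> S" and w: "w = \<phi> z"
      by blast
    have "deriv \<phi> z \<noteq> 0"
      using \<psi>'[OF z] by auto
    have "deriv (g \<circ> \<psi>) w = deriv g (\<psi> w) * deriv \<psi> w"
      using \<open>open S\<close> \<open>open (\<phi> ` S)\<close> g \<psi> z
      by (intro deriv_chain) (auto simp: w inv intro: holomorphic_on_imp_differentiable_at)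
    also have "\<dots> = deriv g z / deriv \<phi> z"
      using \<psi>'[OF z] \<open>deriv \<phi> z \<noteq> 0\<close> by (simp add: w inv[OF z] field_simps)
    finally show ?thesis
      using shear z norm_less_norm_add_iff_Re_divide[OF \<open>deriv \<phi> z \<noteq> 0\<close>]
      by (auto simp: sense_preserving_shear_on_def)
  qed
  note F = horizontal_shear_inj_on_convex_real_dir[OF dom G pos, folded F_def]
  have f: "f z = F (\<phi> z)" if "z \<in> S" for z
    using shear that by (simp add: sense_preserving_shear_on_def F_def inv)
  show "inj_on f S"
    using comp_inj_on[OF inj F(1)] f by (simp add: inj_on_def)
  have "f ` S = F ` \<phi> ` S"
    using f by (simp add: image_image)
  then show "domain_convex_real_dir (f ` S)"
    using F(2) by simp
qed

theorem theorem2: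
  fixes \<phi> f1 f2 f3 :: "complex \<Rightarrow> complex" and t :: real
  assumes "\<phi> \<in> class_A"
    and "f1 \<in> class_SH0" and "f2 \<in> class_SH0"
    and "f1 \<in> class_W (-1) \<phi>" and "f2 \<in> class_W (-1) \<phi>"
    and "inj_on \<phi> unit_disc" and "convex_real_dir \<phi>"
    and "0 \<le> t" and "t \<le> 1"
    and "f3 = (\<lambda>z. of_real t * f1 z + of_real (1 - t) * f2 z)"
  shows "inj_on f3 unit_disc \<and> convex_real_dir f3"
proof -
  obtain g1 g2 where "sense_preserving_shear_on f1 \<phi> g1 unit_disc"
    and "sense_preserving_shear_on f2 \<phi> g2 unit_disc"
    using class_SH0_class_W_shearE assms(2-5) by metis
  from sense_preserving_shear_on_convex_combination[OF open_ball assms(8,9) this]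
  obtain g3 where shear: "sense_preserving_shear_on f3 \<phi> g3 unit_disc"
    unfolding assms(10) by blast
  have "\<phi> holomorphic_on unit_disc"
    using assms(1) by (simp add: class_A_def)
  from clunie_sheil_small_shear[OF open_ball this assms(6) _ shear] show ?thesis
    using assms(7) by (simp add: convex_real_dir_def)
qed

end
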